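(* A structural abstract logic $\mathcal{S}$ in a propositional language $\mathcal{L}$ is couniform if, and only if, it is determined by a couniform bundle (equivalently, a couniform atlas) of $\mathcal{L}$-matrices, i.e. there is a couniform bundle $\mathcal{B}$ of $\mathcal{L}$-matrices with $\vdash_{\mathcal{S}}\,=\,\vdash_{\mathcal{B}}$.
   Context: $\mathcal{L}$ is an abstract propositional language, given by a set $\mathcal{V}_{\mathcal{L}}$ of variables, a set of constants and a set of finitary connectives. $\mathbf{Fm}_{\mathcal{L}}$ is the set of all $\mathcal{L}$-formulae; $\mathcal{V}(\alpha)$ is the set of variables occurring in $\alpha$, and $\mathcal{V}(X)=\bigcup_{\alpha\in X}\mathcal{V}(\alpha)$ for $X\subseteq\mathbf{Fm}_{\mathcal{L}}$. A structural abstract logic $\mathcal{S}$ is given by a (not necessarily finitary) consequence relation $\vdash_{\mathcal{S}}$ on $\mathbf{Fm}_{\mathcal{L}}$ (reflexive, monotone, transitive/closed under cut) closed under substitutions, equivalently by its consequence operator $\mathbf{Cn}_{\mathcal{S}}(X)=\{\alpha : X\vdash_{\mathcal{S}}\alpha\}$. A set $X$ is consistent if $\mathbf{Cn}_{\mathcal{S}}(X)\neq\mathbf{Fm}_{\mathcal{L}}$. $\mathcal{S}$ is couniform if for any collection $\{X_i\}_{i\in I}$ of formula sets with $\mathcal{V}(X_i)\cap\mathcal{V}(X_{i'})=\varnothing$ for $i\neq i'$ and $\mathcal{V}(\bigcup_{i\in I}X_i)\neq\mathcal{V}_{\mathcal{L}}$: if $\bigcup_{i\in I}X_i$ is inconsistent,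 then at least one $X_i$ is inconsistent. An $\mathcal{L}$-matrix is a pair $\mathbf{M}=\langle\mathbf{A},D\rangle$ with $\mathbf{A}$ an algebra of the signature of $\mathcal{L}$ and $D\subseteq|\mathbf{A}|$. $X\models_{\mathbf{M}}\alpha$ means: for every valuation $v$ in $\mathbf{A}$ (homomorphism from the formula algebra to $\mathbf{A}$), if $v[X]\subseteq D$ then $v[\alpha]\in D$. For a nonempty family $\mathcal{M}=\{\mathbf{M}_j\}_{j\in J}$, $X\vdash_{\mathcal{M}}\alpha$ iff $X\models_{\mathbf{M}_j}\alpha$ for each $j\in J$. A nonempty family of $\mathcal{L}$-matrices is a bundle if its algebras are pairwise isomorphic. An atlas is a pair $\langle\mathbf{A},\{D_i\}_{i\in I}\rangle$ with each $D_i\subseteq|\mathbf{A}|$; its corresponding bundle is $\{\langle\mathbf{A},D_i\rangle\}_{i\in I}$, and its consequence is that of the corresponding bundle. $\mathfrak{S}(\mathbf{M})$, for $\mathbf{M}=\langle\mathbf{A},D\rangle$, is the set of all $X\subseteq\mathbf{Fm}_{\mathcal{L}}$ such that $X=\{\alpha\in\mathbf{Fm}_{\mathcal{L}} : v[\alpha]\in D\}$ for some valuation $v$ in $\mathbf{A}$. A nonempty set $\{\mathbf{M}_j\}_{j\in J}$ of $\mathcal{L}$-matrices is couniform if for any collection $\{X_i\}_{i\in I}$ of formula sets with $\mathcal{V}(X_i)\cap\mathcal{V}(X_{i'})=\varnothing$ for $i\neq i'$ and $\mathcal{V}(\bigcup_{i\in I}X_i)\neq\mathcal{V}_{\mathcal{L}}$: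 if for every $i\in I$ there are $j\in J$ and $Z_j\in\mathfrak{S}(\mathbf{M}_j)$ with $X_i\subseteq Z_j\subsetneq\mathbf{Fm}_{\mathcal{L}}$, then there are $k\in J$ and $Z_k\in\mathfrak{S}(\mathbf{M}_k)$ with $\bigcup_{i\in I}X_i\subseteq Z_k\subsetneq\mathbf{Fm}_{\mathcal{L}}$. An atlas is couniform if its corresponding bundle is couniform. *)

theory Defs
  imports "HOL-Library.Disjoint_Sets"
begin

record ('v, 'k, 'c) language =
  variables :: "'v set"
  constants :: "'k set"
  connectives :: "'c set"
  arity :: "'c \<Rightarrow> nat"

datatype (fm_vars: 'v, 'k, 'c) fm =
  Var 'v | Const 'k | App 'c "('v, 'k, 'c) fm list"

inductive_set Fm :: "('v, 'k, 'c) language \<Rightarrow> ('v, 'k, 'c) fm set"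
  for L :: "('v, 'k, 'c) language" where
  "x \<in> variables L \<Longrightarrow> Var x \<in> Fm L"
| "k \<in> constants L \<Longrightarrow> Const k \<in> Fm L"
| "\<lbrakk>c \<in> connectives L; length \<alpha>s = arity L c; \<forall>\<alpha> \<in> set \<alpha>s. \<alpha> \<in> Fm L\<rbrakk>
     \<Longrightarrow> App c \<alpha>s \<in> Fm L"

definition set_vars :: "('v, 'k, 'c) fm set \<Rightarrow> 'v set" where
  "set_vars X = (\<Union>\<alpha>\<in>X. fm_vars \<alpha>)"


subsection \<open>Algebras of the signature of a language\<close>

record ('k, 'c, 'a) alg =
  carrier :: "'a set"
  const_val :: "'k \<Rightarrow> 'a"
  op_val :: "'c \<Rightarrow> 'a list \<Rightarrow> 'a"

definition is_algebra :: "('v, 'k, 'c) language \<Rightarrow> ('k, 'c, 'a) alg \<Rightarrow> bool" where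
  "is_algebra L A \<longleftrightarrow>
     carrier A \<noteq> {} \<and>
     (\<forall>k \<in> constants L. const_val A k \<in> carrier A) \<and>
     (\<forall>c \<in> connectives L. \<forall>xs \<in> lists (carrier A).
        length xs = arity L c \<longrightarrow> op_val A c xs \<in> carrier A)"

definition is_hom ::
  "('v, 'k, 'c) language \<Rightarrow> ('k, 'c, 'a) alg \<Rightarrow> ('k, 'c, 'b) alg \<Rightarrow> ('a \<Rightarrow> 'b) \<Rightarrow> bool" where
  "is_hom L A B h \<longleftrightarrow>
     h ` carrier A \<subseteq> carrier B \<and>
     (\<forall>k \<in> constants L. h (const_val A k) = const_val B k) \<and>
     (\<forall>c \<in> connectives L. \<forall>xs \<in> lists (carrier A).
        length xs = arity L c \<longrightarrow> h (op_val A c xs) = op_val B c (map h xs))"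

definition isomorphic ::
  "('v, 'k, 'c) language \<Rightarrow> ('k, 'c, 'a) alg \<Rightarrow> ('k, 'c, 'b) alg \<Rightarrow> bool" where
  "isomorphic L A B \<longleftrightarrow> (\<exists>h. is_hom L A B h \<and> bij_betw h (carrier A) (carrier B))"

definition fm_algebra ::
  "('v, 'k, 'c) language \<Rightarrow> ('k, 'c, ('v, 'k, 'c) fm) alg" where
  "fm_algebra L = \<lparr>carrier = Fm L, const_val = Const, op_val = App\<rparr>"

text \<open>Only the restriction of a valuation to \<open>Fm L\<close> matters.\<close>

definition valuation ::
  "('v, 'k, 'c) language \<Rightarrow> ('k, 'c, 'a) alg \<Rightarrow> (('v, 'k, 'c) fm \<Rightarrow> 'a) \<Rightarrow> bool" where
  "valuation L A v \<longleftrightarrow> is_hom L (fm_algebra L) A v"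

text \<open>Substitutions are the endomorphisms of the formula algebra; on \<open>Fm L\<close> they are exactly the
  homomorphic extensions of maps from variables to formulae.\<close>

definition substitution ::
  "('v, 'k, 'c) language \<Rightarrow> (('v, 'k, 'c) fm \<Rightarrow> ('v, 'k, 'c) fm) \<Rightarrow> bool" where
  "substitution L \<sigma> \<longleftrightarrow> is_hom L (fm_algebra L) (fm_algebra L) \<sigma>"


subsection \<open>Structural abstract logics\<close>

type_synonym ('v, 'k, 'c) conseq = "('v, 'k, 'c) fm set \<Rightarrow> ('v, 'k, 'c) fm \<Rightarrow> bool"

text \<open>The first conjunct makes the relation live on \<open>Fm L\<close>, so that two consequence relations on
  \<open>Fm L\<close> coincide iff they are equal as predicates.\<close>

definition structural_logic :: "('v, 'k, 'c) language \<Rightarrow> ('v, 'k, 'c) conseq \<Rightarrow> bool" where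
  "structural_logic L S \<longleftrightarrow>
     (\<forall>X \<alpha>. S X \<alpha> \<longrightarrow> X \<subseteq> Fm L \<and> \<alpha> \<in> Fm L) \<and>
     (\<forall>X \<alpha>. X \<subseteq> Fm L \<and> \<alpha> \<in> X \<longrightarrow> S X \<alpha>) \<and>
     (\<forall>X Y \<alpha>. X \<subseteq> Y \<and> Y \<subseteq> Fm L \<and> S X \<alpha> \<longrightarrow> S Y \<alpha>) \<and>
     (\<forall>X Y \<alpha>. X \<subseteq> Fm L \<and> (\<forall>\<beta>\<in>Y. S X \<beta>) \<and> S Y \<alpha> \<longrightarrow> S X \<alpha>) \<and>
     (\<forall>\<sigma> X \<alpha>. substitution L \<sigma> \<and> S X \<alpha> \<longrightarrow> S (\<sigma> ` X) (\<sigma> \<alpha>))"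

definition Cn ::
  "('v, 'k, 'c) conseq \<Rightarrow> ('v, 'k, 'c) fm set \<Rightarrow> ('v, 'k, 'c) fm set" where
  "Cn S X = {\<alpha>. S X \<alpha>}"

definition consistent ::
  "('v, 'k, 'c) language \<Rightarrow> ('v, 'k, 'c) conseq \<Rightarrow> ('v, 'k, 'c) fm set \<Rightarrow> bool" where
  "consistent L S X \<longleftrightarrow> Cn S X \<noteq> Fm L"

text \<open>A collection of formula sets is represented by the set of its members. An indexed family with
  pairwise disjoint variables can only repeat a variable-free member, and repetitions affect neither
  the union nor the conditions on the members. The empty collection is allowed.\<close>

definition separated_collection ::
  "('v, 'k, 'c) language \<Rightarrow> ('v, 'k, 'c) fm set set \<Rightarrow> bool" where
  "separated_collection L \<X> \<longleftrightarrow>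
     (\<forall>X\<in>\<X>. X \<subseteq> Fm L) \<and>
     disjoint_family_on set_vars \<X> \<and>
     set_vars (\<Union>\<X>) \<noteq> variables L"

definition couniform_logic :: "('v, 'k, 'c) language \<Rightarrow> ('v, 'k, 'c) conseq \<Rightarrow> bool" where
  "couniform_logic L S \<longleftrightarrow>
     (\<forall>\<X>. separated_collection L \<X> \<and> \<not> consistent L S (\<Union>\<X>)
        \<longrightarrow> (\<exists>X\<in>\<X>. \<not> consistent L S X))"


subsection \<open>Matrices, bundles and atlases\<close>

type_synonym ('k, 'c, 'a) matrix = "('k, 'c, 'a) alg \<times> 'a set"

definition is_matrix :: "('v, 'k, 'c) language \<Rightarrow> ('k, 'c, 'a) matrix \<Rightarrow> bool" where
  "is_matrix L M \<longleftrightarrow> is_algebra L (fst M) \<and> snd M \<subseteq> carrier (fst M)"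

definition matrix_conseq ::
  "('v, 'k, 'c) language \<Rightarrow> ('k, 'c, 'a) matrix \<Rightarrow> ('v, 'k, 'c) conseq" where
  "matrix_conseq L M X \<alpha> \<longleftrightarrow>
     X \<subseteq> Fm L \<and> \<alpha> \<in> Fm L \<and>
     (\<forall>v. valuation L (fst M) v \<longrightarrow> v ` X \<subseteq> snd M \<longrightarrow> v \<alpha> \<in> snd M)"

text \<open>Families of matrices are represented by the set of their members, since consequence and
  couniformity do not depend on the indexing.\<close>

definition family_conseq ::
  "('v, 'k, 'c) language \<Rightarrow> ('k, 'c, 'a) matrix set \<Rightarrow> ('v, 'k, 'c) conseq" where
  "family_conseq L Ms X \<alpha> \<longleftrightarrow> (\<forall>M\<in>Ms. matrix_conseq L M X \<alpha>)"

definition is_bundle :: "('v, 'k, 'c) language \<Rightarrow> ('k, 'c, 'a) matrix set \<Rightarrow> bool" where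
  "is_bundle L Ms \<longleftrightarrow>
     Ms \<noteq> {} \<and> (\<forall>M\<in>Ms. is_matrix L M) \<and>
     (\<forall>M\<in>Ms. \<forall>N\<in>Ms. isomorphic L (fst M) (fst N))"

definition matrix_theories ::
  "('v, 'k, 'c) language \<Rightarrow> ('k, 'c, 'a) matrix \<Rightarrow> ('v, 'k, 'c) fm set set" where
  "matrix_theories L M =
     {X. \<exists>v. valuation L (fst M) v \<and> X = {\<alpha> \<in> Fm L. v \<alpha> \<in> snd M}}"

definition couniform_family ::
  "('v, 'k, 'c) language \<Rightarrow> ('k, 'c, 'a) matrix set \<Rightarrow> bool" where
  "couniform_family L Ms \<longleftrightarrow>
     (\<forall>\<X>. separated_collection L \<X> \<and>
        (\<forall>X\<in>\<X>. \<exists>M\<in>Ms. \<exists>Z\<in>matrix_theories L M. X \<subseteq> Z \<and> Z \<subset> Fm L)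
        \<longrightarrow> (\<exists>M\<in>Ms. \<exists>Z\<in>matrix_theories L M. \<Union>\<X> \<subseteq> Z \<and> Z \<subset> Fm L))"

type_synonym ('k, 'c, 'a) atlas = "('k, 'c, 'a) alg \<times> 'a set set"

text \<open>The family of designated sets is nonempty because the corresponding bundle has to be.\<close>

definition is_atlas :: "('v, 'k, 'c) language \<Rightarrow> ('k, 'c, 'a) atlas \<Rightarrow> bool" where
  "is_atlas L T \<longleftrightarrow>
     is_algebra L (fst T) \<and> snd T \<noteq> {} \<and> (\<forall>D\<in>snd T. D \<subseteq> carrier (fst T))"

definition atlas_bundle :: "('k, 'c, 'a) atlas \<Rightarrow> ('k, 'c, 'a) matrix set" where
  "atlas_bundle T = Pair (fst T) ` snd T"

definition atlas_conseq ::
  "('v, 'k, 'c) language \<Rightarrow> ('k, 'c, 'a) atlas \<Rightarrow> ('v, 'k, 'c) conseq" where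
  "atlas_conseq L T = family_conseq L (atlas_bundle T)"

definition couniform_atlas :: "('v, 'k, 'c) language \<Rightarrow> ('k, 'c, 'a) atlas \<Rightarrow> bool" where
  "couniform_atlas L T \<longleftrightarrow> couniform_family L (atlas_bundle T)"

end

(* A formula set is consistent for the logic of a nonempty family of matrices iff it lies in a proper
   theory v^{-1}[D] of one of them, so a family is couniform iff its logic is. It remains to
   determine every structural logic by some atlas: the Lindenbaum atlas, consisting of the formula
   algebra with all theories of the logic as designated sets. *)
theory Submission
  imports Defs
begin

text \<open>A formula that does not follow from \<open>X\<close> is refuted by some matrix and
  valuation \<open>v\<close>. The set of formulae that \<open>v\<close> designates is then a theory
  that includes \<open>X\<close> and omits that formula. Conversely, any formula outside a proper
  theory above \<open>X\<close> is refuted by the valuation behind that theory.\<close>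

lemma consistent_family_conseq_iff:
  assumes "X \<subseteq> Fm L" "Ms \<noteq> {}"
  shows "consistent L (family_conseq L Ms) X \<longleftrightarrow>
    (\<exists>M\<in>Ms. \<exists>Z\<in>matrix_theories L M. X \<subseteq> Z \<and> Z \<subset> Fm L)"
proof -
  \<comment> \<open>Nonemptiness keeps \<open>Cn\<close> within \<open>Fm L\<close>: over an empty
    family everything of the formula type, well-formed or not, would be a consequence.\<close>
  have "consistent L (family_conseq L Ms) X \<longleftrightarrow>
      (\<exists>\<alpha>\<in>Fm L. \<exists>M\<in>Ms. \<not> matrix_conseq L M X \<alpha>)"
    using \<open>Ms \<noteq> {}\<close> unfolding consistent_def Cn_def family_conseq_def matrix_conseq_def by blast
  also have "\<dots> \<longleftrightarrow> (\<exists>M\<in>Ms. \<exists>v. valuation L (fst M) v \<and>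
      X \<subseteq> {\<alpha> \<in> Fm L. v \<alpha> \<in> snd M} \<and> {\<alpha> \<in> Fm L. v \<alpha> \<in> snd M} \<subset> Fm L)"
    using assms unfolding matrix_conseq_def by blast
  also have "\<dots> \<longleftrightarrow> (\<exists>M\<in>Ms. \<exists>Z\<in>matrix_theories L M. X \<subseteq> Z \<and> Z \<subset> Fm L)"
    unfolding matrix_theories_def by blast
  finally show ?thesis .
qed

text \<open>Once consistency is read as lying in a proper theory, the two notions of couniformity
  are contrapositives of each other for each separated collection.\<close>

lemma couniform_logic_family_conseq_iff:
  assumes "Ms \<noteq> {}"
  shows "couniform_logic L (family_conseq L Ms) \<longleftrightarrow> couniform_family L Ms"
proof -
  have members: "(\<exists>X\<in>\<X>. \<not> consistent L (family_conseq L Ms) X) \<longleftrightarrow>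
        \<not> (\<forall>X\<in>\<X>. \<exists>M\<in>Ms. \<exists>Z\<in>matrix_theories L M. X \<subseteq> Z \<and> Z \<subset> Fm L)"
    and union: "consistent L (family_conseq L Ms) (\<Union>\<X>) \<longleftrightarrow>
        (\<exists>M\<in>Ms. \<exists>Z\<in>matrix_theories L M. \<Union>\<X> \<subseteq> Z \<and> Z \<subset> Fm L)"
    if "separated_collection L \<X>" for \<X>
  proof -
    have sub: "\<forall>X\<in>\<X>. X \<subseteq> Fm L"
      using that by (simp add: separated_collection_def)
    then show "(\<exists>X\<in>\<X>. \<not> consistent L (family_conseq L Ms) X) \<longleftrightarrow>
        \<not> (\<forall>X\<in>\<X>. \<exists>M\<in>Ms. \<exists>Z\<in>matrix_theories L M. X \<subseteq> Z \<and> Z \<subset> Fm L)"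
      by (simp add: consistent_family_conseq_iff[OF _ assms] cong: bex_cong)
    from sub show "consistent L (family_conseq L Ms) (\<Union>\<X>) \<longleftrightarrow>
        (\<exists>M\<in>Ms. \<exists>Z\<in>matrix_theories L M. \<Union>\<X> \<subseteq> Z \<and> Z \<subset> Fm L)"
      by (intro consistent_family_conseq_iff[OF _ assms] Union_least) simp
  qed
  show ?thesis
    unfolding couniform_logic_def couniform_family_def
  proof (intro iff_allI)
    fix \<X>
    show "(separated_collection L \<X> \<and> \<not> consistent L (family_conseq L Ms) (\<Union>\<X>) \<longrightarrow>
          (\<exists>X\<in>\<X>. \<not> consistent L (family_conseq L Ms) X)) \<longleftrightarrow>
        (separated_collection L \<X> \<and>
          (\<forall>X\<in>\<X>. \<exists>M\<in>Ms. \<exists>Z\<in>matrix_theories L M. X \<subseteq> Z \<and> Z \<subset> Fm L) \<longrightarrow>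
          (\<exists>M\<in>Ms. \<exists>Z\<in>matrix_theories L M. \<Union>\<X> \<subseteq> Z \<and> Z \<subset> Fm L))"
    proof (cases "separated_collection L \<X>")
      case True
      show ?thesis
        unfolding members[OF True] union[OF True] by argo
    qed simp
  qed
qed

lemma isomorphic_refl: "isomorphic L A A"
  unfolding isomorphic_def is_hom_def
  by (intro exI[of _ "\<lambda>x. x"]) (simp add: bij_betw_def)

lemma is_bundle_atlas_bundle: "is_atlas L T \<Longrightarrow> is_bundle L (atlas_bundle T)"
  unfolding is_atlas_def is_bundle_def is_matrix_def atlas_bundle_def
  by (auto intro: isomorphic_refl)

text \<open>The improper theory \<open>Fm L\<close> is deliberately kept: it may be the only one,
  and an atlas needs at least one designated set.\<close>

definition logic_theories :: "('v, 'k, 'c) language \<Rightarrow> ('v, 'k, 'c) conseq \<Rightarrow> ('v, 'k, 'c) fm set set"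
  where "logic_theories L S = {D. D \<subseteq> Fm L \<and> (\<forall>\<alpha>. S D \<alpha> \<longrightarrow> \<alpha> \<in> D)}"

definition lindenbaum_atlas ::
  "('v, 'k, 'c) language \<Rightarrow> ('v, 'k, 'c) conseq \<Rightarrow> ('k, 'c, ('v, 'k, 'c) fm) atlas"
  where "lindenbaum_atlas L S = (fm_algebra L, logic_theories L S)"

lemma is_algebra_fm_algebra: "Fm L \<noteq> {} \<Longrightarrow> is_algebra L (fm_algebra L)"
  unfolding is_algebra_def fm_algebra_def by (auto intro: Fm.intros)

lemma is_atlas_lindenbaum_atlas:
  assumes "structural_logic L S" "Fm L \<noteq> {}"
  shows "is_atlas L (lindenbaum_atlas L S)"
proof -
  have "Fm L \<in> logic_theories L S"
    using assms(1)[unfolded structural_logic_def, THEN conjunct1]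
    unfolding logic_theories_def by blast
  moreover have "\<And>D. D \<in> logic_theories L S \<Longrightarrow> D \<subseteq> carrier (fm_algebra L)"
    by (simp add: logic_theories_def fm_algebra_def)
  ultimately show ?thesis
    using is_algebra_fm_algebra[OF assms(2)] unfolding is_atlas_def lindenbaum_atlas_def by auto
qed

lemma valuation_fm_algebra_ident: "valuation L (fm_algebra L) (\<lambda>\<alpha>. \<alpha>)"
  unfolding valuation_def is_hom_def by simp

text \<open>Soundness is structurality, since valuations in the formula algebra are substitutions.
  Completeness needs only the identity valuation and the theory generated by the premises.\<close>

lemma atlas_conseq_lindenbaum_atlas:
  assumes "structural_logic L S"
  shows "atlas_conseq L (lindenbaum_atlas L S) = S"
proof (intro ext iffI)
  note axioms = assms[unfolded structural_logic_def]
  have lives: "\<And>X \<alpha>. S X \<alpha> \<Longrightarrow> X \<subseteq> Fm L \<and> \<alpha> \<in> Fm L"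
    using axioms[THEN conjunct1] by blast
  have refl: "\<And>X \<alpha>. X \<subseteq> Fm L \<Longrightarrow> \<alpha> \<in> X \<Longrightarrow> S X \<alpha>"
    using axioms[THEN conjunct2, THEN conjunct1] by blast
  have mono: "\<And>X Y \<alpha>. X \<subseteq> Y \<Longrightarrow> Y \<subseteq> Fm L \<Longrightarrow> S X \<alpha> \<Longrightarrow> S Y \<alpha>"
    using axioms[THEN conjunct2, THEN conjunct2, THEN conjunct1] by blast
  have cut: "\<And>X Y \<alpha>. X \<subseteq> Fm L \<Longrightarrow> \<forall>\<beta>\<in>Y. S X \<beta> \<Longrightarrow> S Y \<alpha> \<Longrightarrow> S X \<alpha>"
    using axioms[THEN conjunct2, THEN conjunct2, THEN conjunct2, THEN conjunct1] by blast
  have subst: "\<And>\<sigma> X \<alpha>. substitution L \<sigma> \<Longrightarrow> S X \<alpha> \<Longrightarrow> S (\<sigma> ` X) (\<sigma> \<alpha>)"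
    using axioms[THEN conjunct2, THEN conjunct2, THEN conjunct2, THEN conjunct2] by blast
  have conseq_iff: "atlas_conseq L (lindenbaum_atlas L S) X \<alpha> \<longleftrightarrow>
      (\<forall>D\<in>logic_theories L S. matrix_conseq L (fm_algebra L, D) X \<alpha>)" for X \<alpha>
    by (simp add: atlas_conseq_def family_conseq_def atlas_bundle_def lindenbaum_atlas_def)
  fix X \<alpha>
  {
    assume "S X \<alpha>"
    have "\<sigma> \<alpha> \<in> D"
      if D: "D \<in> logic_theories L S" and \<sigma>: "valuation L (fm_algebra L) \<sigma>" "\<sigma> ` X \<subseteq> D" for D \<sigma>
    proof -
      \<comment> \<open>Structurality moves the consequence along the substitution
        \<open>\<sigma>\<close>. Monotonicity then enlarges the premises to \<open>D\<close>, which
        is closed under \<open>S\<close>.\<close>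
      have "S (\<sigma> ` X) (\<sigma> \<alpha>)"
        using \<sigma>(1) \<open>S X \<alpha>\<close> by (intro subst) (simp_all add: substitution_def valuation_def)
      then show ?thesis
        using mono[OF \<sigma>(2)] D by (simp add: logic_theories_def)
    qed
    then show "atlas_conseq L (lindenbaum_atlas L S) X \<alpha>"
      using lives[OF \<open>S X \<alpha>\<close>] by (simp add: conseq_iff matrix_conseq_def)
  }
  {
    assume *: "atlas_conseq L (lindenbaum_atlas L S) X \<alpha>"
    \<comment> \<open>Any theory would serve here: one member of the family is enough to read off
      that the premises are formulae.\<close>
    have "Fm L \<in> logic_theories L S"
      using lives unfolding logic_theories_def by blast
    then have X: "X \<subseteq> Fm L"
      using * unfolding conseq_iff matrix_conseq_def by blast
    \<comment> \<open>By cut, whatever follows from \<open>Cn S X\<close> already follows from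
      \<open>X\<close>.\<close>
    have "Cn S X \<in> logic_theories L S"
      using lives cut[OF X, of "Cn S X"] by (auto simp: logic_theories_def Cn_def)
    then have "matrix_conseq L (fm_algebra L, Cn S X) X \<alpha>"
      using * unfolding conseq_iff by blast
    moreover have "X \<subseteq> Cn S X"
      using refl[OF X] unfolding Cn_def by blast
    \<comment> \<open>The identity valuation sends \<open>X\<close> into the designated set
      \<open>Cn S X\<close>, so it must send \<open>\<alpha>\<close> there too.\<close>
    ultimately have "\<alpha> \<in> Cn S X"
      using valuation_fm_algebra_ident[of L] unfolding matrix_conseq_def by auto
    then show "S X \<alpha>"
      by (simp add: Cn_def)
  }
qed

lemma structural_logic_determined_by_atlas:
  fixes L :: "('v, 'k, 'c) language"
  assumes "structural_logic L S"
  obtains T :: "('k, 'c, ('v, 'k, 'c) fm) atlas"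
  where "is_atlas L T" "S = atlas_conseq L T"
proof (cases "Fm L = {}")
  \<comment> \<open>Without formulae the formula algebra is not an algebra, since its carrier is empty.\<close>
  case True
  define A :: "('k, 'c, ('v, 'k, 'c) fm) alg"
    where "A = \<lparr>carrier = UNIV, const_val = Const, op_val = App\<rparr>"
  have "is_atlas L (A, {UNIV})"
    by (simp add: is_atlas_def is_algebra_def A_def)
  \<comment> \<open>Both relations hold only of formulae, so here both are empty.\<close>
  moreover have "S = atlas_conseq L (A, {UNIV})"
    using True assms[unfolded structural_logic_def, THEN conjunct1]
    by (intro ext) (auto simp: atlas_conseq_def family_conseq_def atlas_bundle_def
        matrix_conseq_def)
  ultimately show ?thesis by (rule that)
next
  case False
  show ?thesis
    by (rule that[OF is_atlas_lindenbaum_atlas[OF assms False]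
          atlas_conseq_lindenbaum_atlas[OF assms, symmetric]])
qed

lemma couniform_logic_if_determined_by_bundle:
  fixes L :: "('v, 'k, 'c) language"
  assumes "\<exists>B :: ('k, 'c, 'a) matrix set.
    is_bundle L B \<and> couniform_family L B \<and> S = family_conseq L B"
  shows "couniform_logic L S"
proof -
  from assms obtain B :: "('k, 'c, 'a) matrix set"
    where B: "is_bundle L B" "couniform_family L B" "S = family_conseq L B"
    by blast
  then have "B \<noteq> {}"
    by (simp add: is_bundle_def)
  from couniform_logic_family_conseq_iff[OF this, of L] show ?thesis
    using B by simp
qed

lemma determined_by_bundle_if_determined_by_atlas:
  fixes L :: "('v, 'k, 'c) language"
  assumes "\<exists>T :: ('k, 'c, 'a) atlas. is_atlas L T \<and> couniform_atlas L T \<and> S = atlas_conseq L T"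
  shows "\<exists>B :: ('k, 'c, 'a) matrix set.
    is_bundle L B \<and> couniform_family L B \<and> S = family_conseq L B"
  using assms by (auto simp: couniform_atlas_def atlas_conseq_def dest!: is_bundle_atlas_bundle)

text \<open>Over a nonempty family couniformity depends on the consequence relation alone. Any atlas
  that determines \<open>S\<close> therefore inherits it from \<open>S\<close>, without a look at
  its designated sets.\<close>

lemma determined_by_couniform_atlas:
  fixes L :: "('v, 'k, 'c) language"
  assumes "structural_logic L S" "couniform_logic L S"
  shows "\<exists>T :: ('k, 'c, ('v, 'k, 'c) fm) atlas.
    is_atlas L T \<and> couniform_atlas L T \<and> S = atlas_conseq L T"
proof -
  obtain T :: "('k, 'c, ('v, 'k, 'c) fm) atlas" where T: "is_atlas L T" "S = atlas_conseq L T"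
    using structural_logic_determined_by_atlas[OF assms(1)] .
  have "atlas_bundle T \<noteq> {}"
    using T(1) by (simp add: is_atlas_def atlas_bundle_def)
  then have "couniform_atlas L T"
    using assms(2)
    by (simp add: T(2) couniform_atlas_def atlas_conseq_def couniform_logic_family_conseq_iff)
  then show ?thesis
    using T by blast
qed

text \<open>A HOL formula cannot quantify over carrier types. The equivalences therefore fix the
  type of formulae, which suffices for existence, while the last two conjuncts give the converse for
  an arbitrary carrier type.\<close>

theorem corollary3p2p1:
  fixes L :: "('v, 'k, 'c) language" and S :: "('v, 'k, 'c) conseq"
  assumes "structural_logic L S"
  shows "(couniform_logic L S \<longleftrightarrow>
            (\<exists>B :: ('k, 'c, ('v, 'k, 'c) fm) matrix set.
               is_bundle L B \<and> couniform_family L B \<and> S = family_conseq L B)) \<and>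
         (couniform_logic L S \<longleftrightarrow>
            (\<exists>T :: ('k, 'c, ('v, 'k, 'c) fm) atlas.
               is_atlas L T \<and> couniform_atlas L T \<and> S = atlas_conseq L T)) \<and>
         ((\<exists>B :: ('k, 'c, 'a) matrix set.
               is_bundle L B \<and> couniform_family L B \<and> S = family_conseq L B)
            \<longrightarrow> couniform_logic L S) \<and>
         ((\<exists>T :: ('k, 'c, 'a) atlas.
               is_atlas L T \<and> couniform_atlas L T \<and> S = atlas_conseq L T)
            \<longrightarrow> couniform_logic L S)"
proof (intro conjI iffI impI)
  assume "couniform_logic L S"
  note atlas = determined_by_couniform_atlas[OF assms this]
  show "\<exists>T :: ('k, 'c, ('v, 'k, 'c) fm) atlas.
      is_atlas L T \<and> couniform_atlas L T \<and> S = atlas_conseq L T"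
    by (rule atlas)
  show "\<exists>B :: ('k, 'c, ('v, 'k, 'c) fm) matrix set.
      is_bundle L B \<and> couniform_family L B \<and> S = family_conseq L B"
    by (rule determined_by_bundle_if_determined_by_atlas[OF atlas])
qed (erule couniform_logic_if_determined_by_bundle
      couniform_logic_if_determined_by_bundle[OF determined_by_bundle_if_determined_by_atlas])+

end
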